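(* Let $G$ be a connected $d$-degenerate graph and let $k$ be a prime number with $k > d \ge 2$. Suppose that one of the following holds: (i) $G$ is non-bipartite; (ii) $G$ is bipartite and there are two non-adjacent vertices $u, v$ of $G$ with $d(u)+d(v) < k$. Then $G$ is $(1,k)$-choosable.
   Context: Graphs are finite and simple. $d(v)$ is the degree of $v$, and $E(v)$ is the set of edges incident to $v$. A graph is $d$-degenerate if every subgraph has a vertex of degree at most $d$. A total weighting of $G$ is a map $\phi: V(G)\cup E(G)\to \mathbb{R}$; it is proper if for every edge $uv$, $\sum_{e\in E(u)}\phi(e)+\phi(u) \ne \sum_{e\in E(v)}\phi(e)+\phi(v)$. For a map $\psi: V(G)\cup E(G)\to\{1,2,\dots\}$, a $\psi$-list assignment $L$ assigns to each $z\in V(G)\cup E(G)$ a set $L(z)$ of $\psi(z)$ real numbers; $G$ is total weight $\psi$-choosable if for every $\psi$-list assignment $L$ there is a proper total weighting $\phi$ with $\phi(z)\in L(z)$ for all $z$. $G$ is $(k,k')$-choosable if it is total weight $\psi$-choosable for $\psi(v)=k$ for all vertices $v$ and $\psi(e)=k'$ for all edges $e$. *)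

theory Defs
  imports Complex_Main "HOL-Computational_Algebra.Primes"
begin

definition simple_graph :: "'a set \<Rightarrow> 'a set set \<Rightarrow> bool" where
  "simple_graph V E \<longleftrightarrow> finite V \<and> (\<forall>e\<in>E. e \<subseteq> V \<and> card e = 2)"

definition incident_edges :: "'a set set \<Rightarrow> 'a \<Rightarrow> 'a set set" where
  "incident_edges E v = {e \<in> E. v \<in> e}"

definition vertex_degree :: "'a set set \<Rightarrow> 'a \<Rightarrow> nat" where
  "vertex_degree E v = card (incident_edges E v)"

definition is_subgraph :: "'a set \<Rightarrow> 'a set set \<Rightarrow> 'a set \<Rightarrow> 'a set set \<Rightarrow> bool" where
  "is_subgraph W F V E \<longleftrightarrow> simple_graph W F \<and> W \<subseteq> V \<and> F \<subseteq> E"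

(* The empty subgraph has no vertices at all, so it has to be excluded. *)
definition degenerate :: "nat \<Rightarrow> 'a set \<Rightarrow> 'a set set \<Rightarrow> bool" where
  "degenerate d V E \<longleftrightarrow>
     (\<forall>W F. is_subgraph W F V E \<and> W \<noteq> {} \<longrightarrow> (\<exists>v\<in>W. vertex_degree F v \<le> d))"

definition connected_graph :: "'a set \<Rightarrow> 'a set set \<Rightarrow> bool" where
  "connected_graph V E \<longleftrightarrow>
     V \<noteq> {} \<and> (\<forall>u\<in>V. \<forall>v\<in>V. (u, v) \<in> {(x, y). {x, y} \<in> E}\<^sup>*)"

definition bipartite :: "'a set \<Rightarrow> 'a set set \<Rightarrow> bool" where
  "bipartite V E \<longleftrightarrow>
     (\<exists>A B. A \<union> B = V \<and> A \<inter> B = {} \<and> (\<forall>e\<in>E. \<exists>a\<in>A. \<exists>b\<in>B. e = {a, b}))"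

(* Weightings and list assignments live on the disjoint union of vertices and
   edges: Inl v is the vertex v, Inr e the edge e, and V <+> E is the domain.
   Values outside of V <+> E are irrelevant. *)

definition vertex_sum :: "'a set set \<Rightarrow> ('a + 'a set \<Rightarrow> real) \<Rightarrow> 'a \<Rightarrow> real" where
  "vertex_sum E \<phi> v = (\<Sum>e\<in>incident_edges E v. \<phi> (Inr e)) + \<phi> (Inl v)"

definition proper_weighting :: "'a set set \<Rightarrow> ('a + 'a set \<Rightarrow> real) \<Rightarrow> bool" where
  "proper_weighting E \<phi> \<longleftrightarrow>
     (\<forall>u v. {u, v} \<in> E \<longrightarrow> vertex_sum E \<phi> u \<noteq> vertex_sum E \<phi> v)"

definition list_assignment ::
    "'a set \<Rightarrow> 'a set set \<Rightarrow> ('a + 'a set \<Rightarrow> nat) \<Rightarrow> ('a + 'a set \<Rightarrow> real set) \<Rightarrow> bool" where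
  "list_assignment V E \<psi> L \<longleftrightarrow> (\<forall>z \<in> V <+> E. finite (L z) \<and> card (L z) = \<psi> z)"

(* Intended for \<psi> that is positive on V <+> E. *)
definition total_weight_choosable ::
    "'a set \<Rightarrow> 'a set set \<Rightarrow> ('a + 'a set \<Rightarrow> nat) \<Rightarrow> bool" where
  "total_weight_choosable V E \<psi> \<longleftrightarrow>
     (\<forall>L. list_assignment V E \<psi> L \<longrightarrow>
        (\<exists>\<phi>. proper_weighting E \<phi> \<and> (\<forall>z \<in> V <+> E. \<phi> z \<in> L z)))"

definition pair_choosable :: "nat \<Rightarrow> nat \<Rightarrow> 'a set \<Rightarrow> 'a set set \<Rightarrow> bool" where
  "pair_choosable k k' V E \<longleftrightarrow> total_weight_choosable V E (case_sum (\<lambda>v. k) (\<lambda>e. k'))"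

end

theory Submission
  imports Defs "HOL-Library.Multiset" "HOL-Library.FuncSet"
begin

text \<open>
  Orient each edge and let \<open>A\<^sub>z\<close> be the column of coefficients of the weight of \<open>z\<close> in the
  differences of vertex sums along the edges. By the combinatorial Nullstellensatz it suffices to
  find edge columns, each used fewer than \<open>k\<close> times, whose permanent is nonzero. The permanent is
  divisible by \<open>k\<close> as soon as a column is used \<open>k\<close> times, and it is multilinear; so it is enough
  that \<^emph>\<open>some\<close> columns in the integer span of the edge columns have permanent nonzero modulo \<open>k\<close>.
  Degeneracy gives vertex columns \<open>A\<^sub>v\<close>, each used at most \<open>d < k\<close> times, with permanent
  \<open>\<plusminus>\<close> a product of factorials of numbers at most \<open>d\<close>. Since \<open>A\<^sub>u\<^sub>v = A\<^sub>u + A\<^sub>v\<close>, an odd closed walk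
  puts every \<open>2 A\<^sub>v\<close> in the span, and 2 is invertible modulo \<open>k\<close>. In the bipartite case
  \<open>A\<^sub>v \<plusminus> A\<^sub>u\<close>, used \<open>d(u) + d(v) < k\<close> times, takes care of the edges at \<open>u\<close> and \<open>v\<close>, and the
  degeneracy argument applies to the graph without \<open>u\<close> and \<open>v\<close>.
\<close>

section \<open>Permanents\<close>

text \<open>The columns come as a list, and the value is \<open>0\<close> unless their number equals \<open>card R\<close>.\<close>

fun permanent :: "'r set \<Rightarrow> ('r \<Rightarrow> 'b::comm_ring_1) list \<Rightarrow> 'b" where
  "permanent R [] = of_bool (R = {})"
| "permanent R (c # cs) = (\<Sum>e\<in>R. c e * permanent (R - {e}) cs)"

lemma permanent_cong:
  assumes "list_all2 (\<lambda>c c'. \<forall>e\<in>R. c e = c' e) cs cs'"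
  shows "permanent R cs = permanent R cs'"
  using assms
proof (induction cs arbitrary: cs' R)
  case (Cons c cs)
  then obtain c' ds where cs': "cs' = c' # ds" "\<forall>e\<in>R. c e = c' e"
      "list_all2 (\<lambda>c c'. \<forall>e\<in>R. c e = c' e) cs ds"
    by (auto simp: list_all2_Cons1)
  have "permanent (R - {e}) cs = permanent (R - {e}) ds" for e
    by (intro Cons.IH list.rel_mono_strong[OF cs'(3)]) auto
  then show ?case using cs' by (auto intro!: sum.cong)
qed auto

lemma permanent_add:
  "permanent R (xs @ (\<lambda>e. c e + c' e) # ys) =
     permanent R (xs @ c # ys) + permanent R (xs @ c' # ys)"
  by (induction xs arbitrary: R) (simp_all add: distrib_left distrib_right sum.distrib)

lemma permanent_uminus:
  "permanent R (xs @ (\<lambda>e. - c e) # ys) = - permanent R (xs @ c # ys)"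
  by (induction xs arbitrary: R) (simp_all add: sum_negf)

lemma permanent_zero: "permanent R (xs @ (\<lambda>e. 0) # ys) = 0"
  by (induction xs arbitrary: R) simp_all

lemma permanent_scale:
  "permanent R (map (\<lambda>z e. a * f z e) zs) = a ^ length zs * permanent R (map f zs)"
  by (induction zs arbitrary: R) (simp_all add: sum_distrib_left mult_ac)

text \<open>Since \<open>c\<close> vanishes outside \<open>R0\<close>, the first
  \<open>card R0\<close> columns must occupy exactly the rows of \<open>R0\<close>; each of the
  \<open>fact (card R0)\<close> ways to do so gives the same product.\<close>

lemma permanent_block:
  assumes "finite R" "R0 \<subseteq> R" "\<forall>e\<in>R - R0. c e = 0"
  shows "permanent R (replicate (card R0) c @ cs) =
     fact (card R0) * (\<Prod>e\<in>R0. c e) * permanent (R - R0) cs"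
  using assms
proof (induction "card R0" arbitrary: R R0)
  case 0
  then have "R0 = {}" by (metis card_0_eq finite_subset)
  then show ?case by simp
next
  case (Suc n)
  have fin: "finite R0" using Suc.prems finite_subset by blast
  have *: "c e * permanent (R - {e}) (replicate n c @ cs) =
      fact n * (\<Prod>e\<in>R0. c e) * permanent (R - R0) cs" if "e \<in> R0" for e
  proof -
    have card: "card (R0 - {e}) = n" using Suc.hyps(2) that fin by simp
    have "permanent (R - {e}) (replicate n c @ cs) =
        fact n * (\<Prod>e\<in>R0 - {e}. c e) * permanent (R - {e} - (R0 - {e})) cs"
      using Suc.hyps(1)[of "R0 - {e}" "R - {e}"] Suc.prems card by auto
    moreover have "R - {e} - (R0 - {e}) = R - R0" using that by blast
    ultimately show ?thesis using prod.remove[OF fin that, of c] by (simp add: mult_ac)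
  qed
  have "permanent R (replicate (card R0) c @ cs) =
      (\<Sum>e\<in>R. c e * permanent (R - {e}) (replicate n c @ cs))"
    using Suc.hyps(2)[symmetric] by simp
  also have "\<dots> = (\<Sum>e\<in>R0. c e * permanent (R - {e}) (replicate n c @ cs))"
    using Suc.prems by (intro sum.mono_neutral_right) auto
  also have "\<dots> = (\<Sum>e\<in>R0. fact n * (\<Prod>e\<in>R0. c e) * permanent (R - R0) cs)"
    using * by (intro sum.cong) auto
  also have "\<dots> = fact (card R0) * (\<Prod>e\<in>R0. c e) * permanent (R - R0) cs"
    using Suc.hyps(2)[symmetric] by (simp add: algebra_simps)
  finally show ?case .
qed

text \<open>The coefficient of the monomial \<open>\<Prod>z\<in>#M. x z\<close> in \<open>\<Prod>e\<in>R. \<Sum>z\<in>Z. A z e * x z\<close>.\<close>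

definition form_coeff :: "('z \<Rightarrow> 'r \<Rightarrow> 'b::comm_ring_1) \<Rightarrow> 'r set \<Rightarrow> 'z set \<Rightarrow> 'z multiset \<Rightarrow> 'b" where
  "form_coeff A R Z M =
     (\<Sum>g | g \<in> R \<rightarrow>\<^sub>E Z \<and> image_mset g (mset_set R) = M. \<Prod>e\<in>R. A (g e) e)"

text \<open>Double counting of pairs of a map \<open>g\<close> with value multiset
  \<open>add_mset c M\<close> and a row \<open>e\<close> with \<open>g e = c\<close>: each
  \<open>g\<close> has \<open>Suc (count M c)\<close> such rows, and removing \<open>e\<close>
  leaves a map with multiset \<open>M\<close>.\<close>

lemma form_coeff_add_mset:
  fixes A :: "'z \<Rightarrow> 'r \<Rightarrow> 'b::comm_ring_1"
  assumes "finite R" "finite Z" "c \<in> Z"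
  shows "(\<Sum>e\<in>R. A c e * form_coeff A (R - {e}) Z M) =
     of_nat (Suc (count M c)) * form_coeff A R Z (add_mset c M)"
proof -
  define G where "G = (\<lambda>(R :: 'r set) M. {g. g \<in> R \<rightarrow>\<^sub>E Z \<and> image_mset g (mset_set R) = M})"
  have finG: "finite (G R M)" if "finite R" for R M
    unfolding G_def by (rule finite_subset[of _ "R \<rightarrow>\<^sub>E Z"]) (use that assms in \<open>auto intro: finite_PiE\<close>)
  have card: "card {e \<in> R. g e = c} = Suc (count M c)" if "g \<in> G R (add_mset c M)" for g
  proof -
    have "count (image_mset g (mset_set R)) c = Suc (count M c)"
      using that by (simp add: G_def)
    moreover have "count (image_mset g (mset_set R)) c = card {e \<in> R. g e = c}"
      using assms by (simp add: count_image_mset vimage_def Int_def conj_commute)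
    ultimately show ?thesis by simp
  qed
  have "A c e * (\<Sum>g\<in>G (R - {e}) M. \<Prod>f\<in>R - {e}. A (g f) f) =
      (\<Sum>g | g \<in> G R (add_mset c M) \<and> g e = c. \<Prod>f\<in>R. A (g f) f)" if e: "e \<in> R" for e
    unfolding sum_distrib_left
  proof (rule sum.reindex_bij_witness[where i = "\<lambda>g. restrict g (R - {e})" and j = "\<lambda>g. g(e := c)"])
    fix g assume g: "g \<in> G (R - {e}) M"
    have R: "mset_set R = add_mset e (mset_set (R - {e}))"
      using e assms by (simp add: mset_set.remove)
    have "image_mset (g(e := c)) (mset_set (R - {e})) = image_mset g (mset_set (R - {e}))"
      using assms by (intro image_mset_cong) auto
    then show "g(e := c) \<in> {g. g \<in> G R (add_mset c M) \<and> g e = c}"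
      using g e assms R by (auto simp: G_def PiE_def extensional_def)
    show "restrict (g(e := c)) (R - {e}) = g"
      using g by (auto simp: G_def PiE_def extensional_def restrict_def fun_eq_iff)
    show "(\<Prod>f\<in>R. A ((g(e := c)) f) f) = A c e * (\<Prod>f\<in>R - {e}. A (g f) f)"
      using e assms by (subst prod.remove[of _ e]) (auto intro!: prod.cong)
  next
    fix g assume g: "g \<in> {g. g \<in> G R (add_mset c M) \<and> g e = c}"
    have R: "mset_set R = add_mset e (mset_set (R - {e}))"
      using e assms by (simp add: mset_set.remove)
    have "image_mset (restrict g (R - {e})) (mset_set (R - {e})) = image_mset g (mset_set (R - {e}))"
      using assms by (intro image_mset_cong) auto
    then show "restrict g (R - {e}) \<in> G (R - {e}) M"
      using g R by (auto simp: G_def)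
    show "(restrict g (R - {e}))(e := c) = g"
      using g e by (auto simp: G_def PiE_def extensional_def fun_eq_iff)
  qed
  then have "(\<Sum>e\<in>R. A c e * form_coeff A (R - {e}) Z M) =
      (\<Sum>e\<in>R. \<Sum>g | g \<in> G R (add_mset c M) \<and> g e = c. \<Prod>f\<in>R. A (g f) f)"
    by (simp add: form_coeff_def G_def)
  also have "\<dots> = (\<Sum>g\<in>G R (add_mset c M). \<Sum>e | e \<in> R \<and> g e = c. \<Prod>f\<in>R. A (g f) f)"
    by (intro sum.swap_restrict assms finG)
  also have "\<dots> = (\<Sum>g\<in>G R (add_mset c M). of_nat (Suc (count M c)) * (\<Prod>f\<in>R. A (g f) f))"
    using card by (intro sum.cong) auto
  finally show ?thesis by (simp add: form_coeff_def G_def sum_distrib_left)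
qed

lemma prod_fact_count_add_mset:
  assumes "finite Z" "c \<in> Z"
  shows "(\<Prod>z\<in>Z. fact (count (add_mset c M) z)) =
     (of_nat (Suc (count M c)) * (\<Prod>z\<in>Z. fact (count M z)) :: 'b::{comm_ring_1,semiring_char_0})"
proof -
  have "(\<Prod>z\<in>Z - {c}. fact (count (add_mset c M) z) :: 'b) = (\<Prod>z\<in>Z - {c}. fact (count M z))"
    by (intro prod.cong) auto
  then show ?thesis using assms
    by (subst (1 2) prod.remove[of _ c]) (auto simp: algebra_simps)
qed

text \<open>Each \<open>g\<close> counted by the coefficient arises from as many assignments of list
  positions to rows as there are permutations of equal columns. The factorials explain divisibility
  by a prime repeated as a multiplicity; the other factor feeds the Nullstellensatz.\<close>

lemma permanent_eq_form_coeff: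
  fixes A :: "'z \<Rightarrow> 'r \<Rightarrow> 'b::{comm_ring_1,semiring_char_0}"
  assumes "finite R" "finite Z" "set zs \<subseteq> Z"
  shows "permanent R (map A zs) =
     (\<Prod>z\<in>Z. fact (count (mset zs) z)) * form_coeff A R Z (mset zs)"
  using assms
proof (induction zs arbitrary: R)
  case Nil
  then show ?case
    by (cases "R = {}") (auto simp: form_coeff_def mset_set_empty_iff)
next
  case (Cons c zs)
  have "permanent R (map A (c # zs)) =
      (\<Prod>z\<in>Z. fact (count (mset zs) z)) * (\<Sum>e\<in>R. A c e * form_coeff A (R - {e}) Z (mset zs))"
    using Cons by (auto simp: sum_distrib_left algebra_simps intro!: sum.cong)
  then show ?case
    using Cons.prems prod_fact_count_add_mset[of Z c "mset zs", where 'b = 'b]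
    by (simp add: form_coeff_add_mset mult_ac)
qed

text \<open>Splitting off rows by \<open>permanent_block\<close> keeps a permanent nonzero modulo
  \<open>k\<close>: the prime factors of \<open>fact n\<close> are at most \<open>n\<close>, and the
  entries are units.\<close>

lemma prime_not_dvd_block:
  assumes "prime k" "n < k" "\<And>e. e \<in> R \<Longrightarrow> \<bar>c e\<bar> = 1" "\<not> int k dvd x"
  shows "\<not> int k dvd fact n * (\<Prod>e\<in>R. c e) * x"
proof -
  have "\<not> int k dvd fact n"
    using assms by (metis int_dvd_int_iff linorder_not_less of_nat_fact prime_dvd_fact_iff)
  moreover have "\<bar>\<Prod>e\<in>R. c e\<bar> = 1" using assms(3) by (simp add: abs_prod)
  then have "\<not> int k dvd (\<Prod>e\<in>R. c e)"
    using assms(1) by (metis dvd_abs_iff int_dvd_int_iff not_prime_unit of_nat_1)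
  ultimately show ?thesis
    using assms by (simp add: prime_dvd_mult_iff)
qed

section \<open>Combinatorial Nullstellensatz for products of linear forms\<close>

text \<open>The weights of the divided difference at \<open>n + 1\<close> points, which kills
  polynomials of degree below \<open>n\<close> and returns the leading coefficient in degree
  \<open>n\<close>.\<close>

lemma divided_difference_weights:
  fixes S :: "'b::field set"
  assumes "finite S" "card S = Suc n"
  shows "\<exists>w. \<forall>j\<le>n. (\<Sum>s\<in>S. w s * s ^ j) = of_bool (j = n)"
  using assms
proof (induction n arbitrary: S)
  case 0
  then obtain s where "S = {s}" by (metis One_nat_def card_1_singletonE)
  then show ?case by (intro exI[of _ "\<lambda>_. 1"]) simp
next
  case (Suc n)
  then obtain t S' where S: "S = insert t S'" "t \<notin> S'" "card S' = Suc n"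
    by (metis card_Suc_eq)
  then have fin: "finite S'" using Suc.prems by simp
  obtain w where w: "\<And>j. j \<le> n \<Longrightarrow> (\<Sum>s\<in>S'. w s * s ^ j) = of_bool (j = n)"
    using Suc.IH[OF fin S(3)] by blast
  \<comment> \<open>The value at \<open>t\<close> makes all weights sum to 0, so that
    \<open>s ^ j\<close> may be replaced by \<open>s ^ j - t ^ j\<close>, which is divisible by
    \<open>s - t\<close>.\<close>
  define w' where "w' = (\<lambda>s. if s = t then - (\<Sum>s\<in>S'. w s / (s - t)) else w s / (s - t))"
  have "(\<Sum>s\<in>S. w' s * s ^ j) = of_bool (j = Suc n)" if "j \<le> Suc n" for j
  proof -
    have eq: "(\<Sum>s\<in>S'. w' s * s ^ j) = (\<Sum>s\<in>S'. w s / (s - t) * s ^ j)"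
      using S by (intro sum.cong) (auto simp: w'_def)
    have "(\<Sum>s\<in>S. w' s * s ^ j) = (\<Sum>s\<in>S'. w s / (s - t) * (s ^ j - t ^ j))"
      unfolding S(1) using S fin eq
      by (simp add: w'_def sum_distrib_left sum_distrib_right sum_subtractf algebra_simps)
    also have "\<dots> = (\<Sum>s\<in>S'. \<Sum>i<j. t ^ (j - Suc i) * (w s * s ^ i))"
    proof (intro sum.cong refl)
      fix s assume "s \<in> S'"
      then have "s - t \<noteq> 0" using S by auto
      then show "w s / (s - t) * (s ^ j - t ^ j) = (\<Sum>i<j. t ^ (j - Suc i) * (w s * s ^ i))"
        by (simp add: power_diff_sumr2 sum_distrib_left mult_ac)
    qed
    also have "\<dots> = (\<Sum>i<j. t ^ (j - Suc i) * (\<Sum>s\<in>S'. w s * s ^ i))"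
      by (subst sum.swap) (simp add: sum_distrib_left)
    also have "\<dots> = (\<Sum>i<j. t ^ (j - Suc i) * of_bool (i = n))"
      using w that by (intro sum.cong) auto
    also have "\<dots> = of_bool (j = Suc n)"
    proof (cases "j = Suc n")
      case False
      then show ?thesis using that by (auto intro!: sum.neutral)
    qed (simp add: of_bool_def if_distrib[of "\<lambda>x. _ * x"] cong: if_cong)
    finally show ?thesis .
  qed
  then show ?case by blast
qed

text \<open>Each variable is averaged over \<open>count M z + 1\<close> points with divided difference weights.
  This functional annihilates every monomial of degree \<open>size M\<close> other than \<open>M\<close> itself.\<close>

lemma nullstellensatz_linear_forms:
  fixes A :: "'z \<Rightarrow> 'r \<Rightarrow> 'b::field"
  assumes fin: "finite R" "finite Z"
    and M: "set_mset M \<subseteq> Z" "size M = card R" "form_coeff A R Z M \<noteq> 0"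
    and L: "\<And>z. z \<in> Z \<Longrightarrow> finite (L z) \<and> count M z < card (L z)"
  shows "\<exists>x. (\<forall>z\<in>Z. x z \<in> L z) \<and> (\<forall>e\<in>R. (\<Sum>z\<in>Z. A z e * x z) \<noteq> 0)"
proof (rule ccontr)
  assume neg: "\<not> ?thesis"
  \<comment> \<open>A divided difference of order \<open>count M z\<close> needs exactly one point
    more than its order.\<close>
  have "\<exists>S\<subseteq>L z. card S = Suc (count M z)" if "z \<in> Z" for z
    using L[OF that] by (metis Suc_leI obtain_subset_with_card_n)
  then obtain S where S: "\<And>z. z \<in> Z \<Longrightarrow> S z \<subseteq> L z \<and> card (S z) = Suc (count M z)"
    by metis
  have finS: "finite (S z)" if "z \<in> Z" for z
    using S[OF that] by (intro card_ge_0_finite) simp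
  obtain w where w: "\<And>z j. z \<in> Z \<Longrightarrow> j \<le> count M z \<Longrightarrow>
      (\<Sum>s\<in>S z. w z s * s ^ j) = of_bool (j = count M z)"
    using bchoice[of Z "\<lambda>z w. \<forall>j\<le>count M z. (\<Sum>s\<in>S z. w s * s ^ j) = of_bool (j = count M z)"]
      divided_difference_weights[OF finS] S by blast
  define N where "N = (\<lambda>g :: 'r \<Rightarrow> 'z. image_mset g (mset_set R))"
  have monom: "(\<Prod>e\<in>R. x (g e)) = (\<Prod>z\<in>Z. x z ^ count (N g) z)"
    if "g \<in> R \<rightarrow>\<^sub>E Z" for g and x :: "'z \<Rightarrow> 'b"
  proof -
    have "(\<Prod>e\<in>R. x (g e)) = (\<Prod>z\<in>Z. \<Prod>e\<in>{e \<in> R. g e = z}. x (g e))"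
      using that fin by (intro prod.group[symmetric]) auto
    also have "\<dots> = (\<Prod>z\<in>Z. x z ^ count (N g) z)"
      using fin by (intro prod.cong refl)
        (simp add: N_def count_image_mset vimage_def Int_def conj_commute)
    finally show ?thesis .
  qed
  define \<Phi> where "\<Phi> = (\<lambda>g. \<Prod>z\<in>Z. \<Sum>s\<in>S z. w z s * s ^ count (N g) z)"
  have \<Phi>: "\<Phi> g = of_bool (N g = M)" for g
  \<comment> \<open>Both multisets have size \<open>card R\<close>, so inclusion forces equality.
    Otherwise some exponent falls short of \<open>count M z\<close>, and that factor of
    \<open>\<Phi> g\<close> is 0.\<close>
  proof (cases "M \<subseteq># N g")
    case True
    have "size (N g) = size M" using M by (simp add: N_def)
    then have "N g = M"
      using True by (metis mset_subset_size nless_le subset_mset.le_imp_less_or_eq)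
    then show ?thesis using w by (simp add: \<Phi>_def)
  next
    case False
    then obtain z where z: "count (N g) z < count M z"
      by (metis mset_subset_eqI not_le)
    then have "z \<in> Z" using M(1) by (metis count_eq_zero_iff not_less_zero subsetD)
    then have "\<Phi> g = 0" using w[of z "count (N g) z"] z fin unfolding \<Phi>_def
      by (intro prod_zero) (auto intro!: bexI[of _ z])
    then show ?thesis using False by auto
  qed
  \<comment> \<open>By \<open>neg\<close> the product of forms vanishes on the whole grid, so the
    averaging functional gives 0; expanded into monomials it gives the coefficient of
    \<open>M\<close>.\<close>
  have "0 = (\<Sum>x\<in>Pi\<^sub>E Z S. (\<Prod>z\<in>Z. w z (x z)) * (\<Prod>e\<in>R. \<Sum>z\<in>Z. A z e * x z))"
  proof (intro sum.neutral[symmetric] ballI)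
    fix x assume "x \<in> Pi\<^sub>E Z S"
    then have "\<forall>z\<in>Z. x z \<in> L z" using S by (auto simp: PiE_iff)
    then obtain e where "e \<in> R" "(\<Sum>z\<in>Z. A z e * x z) = 0" using neg by blast
    then show "(\<Prod>z\<in>Z. w z (x z)) * (\<Prod>e\<in>R. \<Sum>z\<in>Z. A z e * x z) = 0"
      using fin by (auto intro!: prod_zero)
  qed
  also have "\<dots> = (\<Sum>x\<in>Pi\<^sub>E Z S. \<Sum>g\<in>R \<rightarrow>\<^sub>E Z.
      (\<Prod>e\<in>R. A (g e) e) * (\<Prod>z\<in>Z. w z (x z) * x z ^ count (N g) z))"
  proof (intro sum.cong refl)
    fix x
    have "(\<Prod>e\<in>R. \<Sum>z\<in>Z. A z e * x z) = (\<Sum>g\<in>R \<rightarrow>\<^sub>E Z. \<Prod>e\<in>R. A (g e) e * x (g e))"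
      using fin by (intro prod_sum_PiE) auto
    also have "\<dots> = (\<Sum>g\<in>R \<rightarrow>\<^sub>E Z. (\<Prod>e\<in>R. A (g e) e) * (\<Prod>z\<in>Z. x z ^ count (N g) z))"
      using monom by (intro sum.cong refl) (simp add: prod.distrib)
    finally show "(\<Prod>z\<in>Z. w z (x z)) * (\<Prod>e\<in>R. \<Sum>z\<in>Z. A z e * x z) = (\<Sum>g\<in>R \<rightarrow>\<^sub>E Z.
      (\<Prod>e\<in>R. A (g e) e) * (\<Prod>z\<in>Z. w z (x z) * x z ^ count (N g) z))"
      by (simp add: sum_distrib_left prod.distrib mult_ac)
  qed
  \<comment> \<open>For fixed \<open>g\<close> the sum over the grid factors into one sum per
    variable.\<close>
  also have "\<dots> = (\<Sum>g\<in>R \<rightarrow>\<^sub>E Z. (\<Prod>e\<in>R. A (g e) e) * \<Phi> g)"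
    unfolding \<Phi>_def using fin finS
    by (subst sum.swap) (simp add: sum_distrib_left[symmetric] prod_sum_PiE)
  also have "\<dots> = (\<Sum>g\<in>{g \<in> R \<rightarrow>\<^sub>E Z. N g = M}. \<Prod>e\<in>R. A (g e) e)"
    unfolding \<Phi> using fin
    by (intro sum.mono_neutral_cong_right) (auto intro: finite_PiE)
  also have "\<dots> = form_coeff A R Z M" by (simp add: form_coeff_def N_def)
  finally show False using M(3) by simp
qed

section \<open>Columns of an oriented graph\<close>

definition incidence :: "'a \<Rightarrow> 'a + 'a set \<Rightarrow> int" where
  "incidence v z = of_bool (case z of Inl w \<Rightarrow> w = v | Inr e \<Rightarrow> v \<in> e)"

lemma vertex_sum_eq_incidence:
  assumes "finite V" "finite E" "v \<in> V"
  shows "vertex_sum E \<phi> v = (\<Sum>z\<in>V <+> E. of_int (incidence v z) * \<phi> z)"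
proof -
  have "(\<Sum>e\<in>incident_edges E v. \<phi> (Inr e)) = (\<Sum>e\<in>E. of_int (incidence v (Inr e)) * \<phi> (Inr e))"
    using assms by (intro sum.mono_neutral_cong_left) (auto simp: incident_edges_def incidence_def)
  moreover have "(\<Sum>w\<in>V. of_int (incidence v (Inl w)) * \<phi> (Inl w)) = \<phi> (Inl v)"
    using assms sum.remove[OF assms(1,3), of "\<lambda>w. of_int (incidence v (Inl w)) * \<phi> (Inl w)"]
    by (simp add: incidence_def)
  ultimately show ?thesis
    using assms by (simp add: vertex_sum_def sum.Plus)
qed

locale oriented_graph =
  fixes V :: "'a set" and E :: "'a set set" and src tgt :: "'a set \<Rightarrow> 'a"
  assumes simple: "simple_graph V E"
    and ends: "e \<in> E \<Longrightarrow> e = {src e, tgt e} \<and> src e \<noteq> tgt e"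
begin

lemma finite_V: "finite V"
  using simple by (simp add: simple_graph_def)

lemma edge_subset: "e \<in> E \<Longrightarrow> e \<subseteq> V"
  using simple by (auto simp: simple_graph_def)

lemma finite_E: "finite E"
  by (rule finite_subset[of _ "Pow V"]) (use edge_subset finite_V in auto)

lemma edge_distinct: "{u, v} \<in> E \<Longrightarrow> u \<noteq> v"
  using ends by fastforce

definition col :: "'a + 'a set \<Rightarrow> 'a set \<Rightarrow> int" where
  "col z e = incidence (src e) z - incidence (tgt e) z"

lemma col_edge: "u \<noteq> v \<Longrightarrow> col (Inr {u, v}) = (\<lambda>e. col (Inl u) e + col (Inl v) e)"
  by (auto simp: col_def incidence_def fun_eq_iff)

lemma col_vertex_outside: "e \<in> E \<Longrightarrow> v \<notin> e \<Longrightarrow> col (Inl v) e = 0"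
  using ends[of e] by (auto simp: col_def incidence_def)

lemma col_vertex_incident: "e \<in> E \<Longrightarrow> v \<in> e \<Longrightarrow> \<bar>col (Inl v) e\<bar> = 1"
  using ends[of e] by (auto simp: col_def incidence_def)

text \<open>The rules other than \<open>edge\<close> correspond to \<open>permanent_zero\<close>,
  \<open>permanent_add\<close> and \<open>permanent_uminus\<close>, so rule induction carries out
  the multilinear expansion.\<close>

inductive_set edge_span :: "('a set \<Rightarrow> int) set" where
  zero: "(\<lambda>e. 0) \<in> edge_span"
| edge: "f \<in> E \<Longrightarrow> col (Inr f) \<in> edge_span"
| add: "c \<in> edge_span \<Longrightarrow> c' \<in> edge_span \<Longrightarrow> (\<lambda>e. c e + c' e) \<in> edge_span"
| uminus: "c \<in> edge_span \<Longrightarrow> (\<lambda>e. - c e) \<in> edge_span"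

lemma edge_span_diff: "c \<in> edge_span \<Longrightarrow> c' \<in> edge_span \<Longrightarrow> (\<lambda>e. c e - c' e) \<in> edge_span"
  using edge_span.add[OF _ edge_span.uminus, of c c'] by simp

text \<open>The last span column is expanded into generators, which join the front of
  \<open>es\<close>; hence \<open>es\<close> is generalised and \<open>cs\<close> shrinks from the
  right.\<close>

lemma edge_span_permanent_dvd:
  assumes dvd: "\<And>es. set es \<subseteq> E \<Longrightarrow> length es = card E \<Longrightarrow> p dvd permanent E (map (\<lambda>f. col (Inr f)) es)"
    and "set cs \<subseteq> edge_span" "set es \<subseteq> E" "length cs + length es = card E"
  shows "p dvd permanent E (cs @ map (\<lambda>f. col (Inr f)) es)"
  using assms(2-)
proof (induction cs arbitrary: es rule: rev_induct)
  case Nil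
  then show ?case using dvd by simp
next
  case (snoc c cs)
  then have "c \<in> edge_span" by simp
  then have "p dvd permanent E (cs @ c # map (\<lambda>f. col (Inr f)) es)"
  proof induction
    case (edge f)
    then show ?case using snoc.IH[of "f # es"] snoc.prems by simp
  qed (simp_all add: permanent_zero permanent_add permanent_uminus)
  then show ?case by simp
qed

lemma pair_choosable_if_permanent:
  assumes k: "prime k" and cs: "set cs \<subseteq> edge_span" "length cs = card E"
    and perm: "\<not> int k dvd permanent E cs"
  shows "pair_choosable 1 k V E"
proof -
  obtain es where es: "set es \<subseteq> E" "length es = card E"
      "\<not> int k dvd permanent E (map (\<lambda>f. col (Inr f)) es)"
    using edge_span_permanent_dvd[of "int k" cs "[]"] cs perm by auto
  define zs :: "('a + 'a set) list" where "zs = map Inr es"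
  define Z where "Z = V <+> E"
  have zs: "set zs \<subseteq> Z" using es by (auto simp: zs_def Z_def)
  have finZ: "finite Z" using finite_V finite_E by (simp add: Z_def)
  have "\<not> int k dvd permanent E (map col zs)" using es by (simp add: zs_def comp_def)
  then have nd: "\<not> int k dvd (\<Prod>z\<in>Z. fact (count (mset zs) z)) * form_coeff col E Z (mset zs)"
    using permanent_eq_form_coeff[OF finite_E finZ zs, of col] by simp
  have cnt: "count (mset zs) z < k" if "z \<in> Z" for z
  proof (rule ccontr)
    assume "\<not> ?thesis"
    \<comment> \<open>A multiplicity of at least \<open>k\<close> would put \<open>k\<close> into
      its factorial.\<close>
    then have "int k dvd fact (count (mset zs) z)"
      by (metis dvd_fact int_dvd_int_iff of_nat_fact not_less k prime_ge_1_nat)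
    also have "\<dots> dvd (\<Prod>z\<in>Z. fact (count (mset zs) z))" using that finZ by (intro dvd_prodI) auto
    finally show False using nd by simp
  qed
  \<comment> \<open>The coefficient is an integer that is nonzero modulo \<open>k\<close>, so it
    stays nonzero over the reals, where the lists live.\<close>
  have "form_coeff (\<lambda>z e. real_of_int (col z e)) E Z (mset zs) = real_of_int (form_coeff col E Z (mset zs))"
    by (simp add: form_coeff_def)
  moreover have "form_coeff col E Z (mset zs) \<noteq> 0" using nd by auto
  ultimately have coeff: "form_coeff (\<lambda>z e. real_of_int (col z e)) E Z (mset zs) \<noteq> 0" by simp
  show ?thesis
    unfolding pair_choosable_def total_weight_choosable_def
  proof (intro allI impI)
    fix L :: "'a + 'a set \<Rightarrow> real set"
    assume L: "list_assignment V E (case_sum (\<lambda>v. 1) (\<lambda>e. k)) L"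
    have "finite (L z) \<and> count (mset zs) z < card (L z)" if z: "z \<in> Z" for z
    proof (cases z)
      case (Inl v)
      \<comment> \<open>Only edge columns occur, so exponent 0 at a vertex is below its list size
        1.\<close>
      then have "count (mset zs) z = 0" by (auto simp: zs_def count_eq_zero_iff)
      then show ?thesis using L z Inl by (auto simp: list_assignment_def Z_def)
    next
      case (Inr f)
      then show ?thesis using L z cnt[OF z] by (auto simp: list_assignment_def Z_def)
    qed
    then obtain \<phi> where \<phi>: "\<forall>z\<in>Z. \<phi> z \<in> L z" "\<forall>e\<in>E. (\<Sum>z\<in>Z. real_of_int (col z e) * \<phi> z) \<noteq> 0"
      using nullstellensatz_linear_forms[OF finite_E finZ _ _ coeff, of L] zs es
      by (auto simp: zs_def)
    have "vertex_sum E \<phi> (src e) \<noteq> vertex_sum E \<phi> (tgt e)" if e: "e \<in> E" for e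
    proof -
      have "src e \<in> V" "tgt e \<in> V" using ends[OF e] edge_subset[OF e] by blast+
      then have "vertex_sum E \<phi> (src e) - vertex_sum E \<phi> (tgt e) = (\<Sum>z\<in>Z. real_of_int (col z e) * \<phi> z)"
        using finite_V finite_E
        by (simp add: vertex_sum_eq_incidence Z_def col_def sum_subtractf algebra_simps)
      then show ?thesis using \<phi>(2) e by auto
    qed
    then have "proper_weighting E \<phi>"
      unfolding proper_weighting_def using ends by (metis doubleton_eq_iff)
    then show "\<exists>\<phi>. proper_weighting E \<phi> \<and> (\<forall>z\<in>V <+> E. \<phi> z \<in> L z)"
      using \<phi>(1) by (auto simp: Z_def)
  qed
qed

text \<open>Peeling off a vertex \<open>v\<close> of degree at most \<open>d\<close>: its column, repeated as often as its
  degree, is supported exactly on the rows of its incident edges.\<close>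

lemma degenerate_permanent:
  assumes "degenerate d V E" "prime k" "d < k" "simple_graph W F" "W \<subseteq> V" "F \<subseteq> E"
  shows "\<exists>hs. set hs \<subseteq> W \<and> length hs = card F \<and>
    \<not> int k dvd permanent F (map (\<lambda>w. col (Inl w)) hs)"
  using assms(4-)
proof (induction "card W" arbitrary: W F)
  case 0
  then have "W = {}" by (simp add: simple_graph_def)
  then have "F = {}" using 0 by (fastforce simp: simple_graph_def)
  then show ?case using \<open>prime k\<close> by (auto intro!: exI[of _ "[]"])
next
  case (Suc n)
  then have "W \<noteq> {}" by auto
  then obtain v where v: "v \<in> W" "vertex_degree F v \<le> d"
    using Suc.prems assms(1) unfolding degenerate_def is_subgraph_def by blast
  define R where "R = incident_edges F v"
  have R: "R \<subseteq> F" "card R \<le> d" using v by (auto simp: R_def incident_edges_def vertex_degree_def)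
  have finF: "finite F" using Suc.prems finite_E finite_subset by blast
  have "simple_graph (W - {v}) (F - R)"
    using Suc.prems by (fastforce simp: simple_graph_def R_def incident_edges_def)
  moreover have "n = card (W - {v})" using Suc.hyps(2) v by (simp add: card_Diff_singleton)
  ultimately obtain hs where hs: "set hs \<subseteq> W - {v}" "length hs = card (F - R)"
      "\<not> int k dvd permanent (F - R) (map (\<lambda>w. col (Inl w)) hs)"
    using Suc.hyps(1)[of "W - {v}" "F - R"] Suc.prems by blast
  have "permanent F (replicate (card R) (col (Inl v)) @ map (\<lambda>w. col (Inl w)) hs) =
      fact (card R) * (\<Prod>e\<in>R. col (Inl v) e) * permanent (F - R) (map (\<lambda>w. col (Inl w)) hs)"
    using finF R Suc.prems(3) by (intro permanent_block) (auto simp: R_def incident_edges_def intro!: col_vertex_outside)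
  moreover have "\<bar>col (Inl v) e\<bar> = 1" if "e \<in> R" for e
    using that Suc.prems(3) by (intro col_vertex_incident) (auto simp: R_def incident_edges_def)
  ultimately have "\<not> int k dvd permanent F (map (\<lambda>w. col (Inl w)) (replicate (card R) v @ hs))"
    using prime_not_dvd_block[OF \<open>prime k\<close> _ _ hs(3), of "card R" R] R assms(3) by auto
  moreover have "length (replicate (card R) v @ hs) = card F"
    using hs(2) card_mono[OF finF R(1)] card_Diff_subset[OF finite_subset[OF R(1) finF] R(1)] by simp
  ultimately show ?case using hs(1) v(1)
    by (intro exI[of _ "replicate (card R) v @ hs"]) auto
qed

section \<open>Signed sums of vertex columns in the span\<close>

lemma edge_span_neighbour:
  assumes "{w, w'} \<in> E"
  shows "(\<lambda>e. col (Inl w) e + col (Inl w') e) \<in> edge_span"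
  using edge_span.edge[OF assms] col_edge[OF edge_distinct[OF assms]] by simp

text \<open>The sign alternates along a walk from \<open>u\<close>: subtracting the combination for
  \<open>w\<close> from \<open>col w + col w'\<close> gives the one for \<open>w'\<close> with the
  opposite sign.\<close>

lemma edge_span_connected:
  assumes "connected_graph V E" "u \<in> V" "w \<in> V"
  shows "(\<lambda>e. col (Inl w) e + col (Inl u) e) \<in> edge_span \<or>
    (\<lambda>e. col (Inl w) e - col (Inl u) e) \<in> edge_span"
proof -
  have "(u, w) \<in> {(x, y). {x, y} \<in> E}\<^sup>*" using assms by (auto simp: connected_graph_def)
  then show ?thesis
  proof induction
    case base
    then show ?case using edge_span.zero by simp
  next
    case (step w w')
    from step.hyps(2) have "(\<lambda>e. col (Inl w) e + col (Inl w') e) \<in> edge_span"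
      by (simp add: edge_span_neighbour)
    from edge_span_diff[OF this] step.IH show ?case
      by (fastforce simp: algebra_simps)
  qed
qed

text \<open>Every edge joins the classes \<open>A\<close> and \<open>B\<close> of the two signs. If
  they were disjoint they would be a bipartition, so some \<open>x\<close> has both signs; the
  difference is twice the column of \<open>u\<close>, and connectedness carries this to
  \<open>w\<close>.\<close>

lemma edge_span_nonbipartite:
  assumes conn: "connected_graph V E" and nonbip: "\<not> bipartite V E" and w: "w \<in> V"
  shows "(\<lambda>e. 2 * col (Inl w) e) \<in> edge_span"
proof -
  obtain u where u: "u \<in> V" using conn by (auto simp: connected_graph_def)
  define A where "A = {w \<in> V. (\<lambda>e. col (Inl w) e - col (Inl u) e) \<in> edge_span}"
  define B where "B = {w \<in> V. (\<lambda>e. col (Inl w) e + col (Inl u) e) \<in> edge_span}"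
  have AB: "A \<union> B = V" using edge_span_connected[OF conn u] by (auto simp: A_def B_def)
  have "A \<inter> B \<noteq> {}"
  proof
    assume disj: "A \<inter> B = {}"
    have swap: "x \<in> A \<longleftrightarrow> y \<in> B" if "{x, y} \<in> E" for x y
    proof -
      have V: "x \<in> V" "y \<in> V" using edge_subset[OF that] by auto
      have s: "(\<lambda>e. col (Inl x) e + col (Inl y) e) \<in> edge_span"
        using edge_span_neighbour[OF that] .
      show ?thesis
        using edge_span_diff[OF s, of "\<lambda>e. col (Inl x) e - col (Inl u) e"]
          edge_span_diff[OF s, of "\<lambda>e. col (Inl y) e + col (Inl u) e"] V
        by (auto simp: A_def B_def algebra_simps)
    qed
    have "\<exists>a\<in>A. \<exists>b\<in>B. e = {a, b}" if "e \<in> E" for e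
    proof -
      from ends[OF that] obtain x y where e: "e = {x, y}" by blast
      then have "x \<in> V" "y \<in> V" using edge_subset[OF that] by auto
      then show ?thesis
        using swap[of x y] swap[of y x] AB disj that e by (metis UnE insert_commute)
    qed
    with AB disj have "bipartite V E"
      unfolding bipartite_def by (intro exI[of _ A] exI[of _ B]) simp
    with nonbip show False by blast
  qed
  then obtain x where x: "(\<lambda>e. col (Inl x) e - col (Inl u) e) \<in> edge_span"
      "(\<lambda>e. col (Inl x) e + col (Inl u) e) \<in> edge_span"
    by (auto simp: A_def B_def)
  have u2: "(\<lambda>e. 2 * col (Inl u) e) \<in> edge_span"
    using edge_span_diff[OF x(2,1)] by (simp add: algebra_simps)
  from edge_span_connected[OF conn u w] show ?thesis
  proof
    assume *: "(\<lambda>e. col (Inl w) e + col (Inl u) e) \<in> edge_span"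
    show ?thesis using edge_span_diff[OF edge_span.add[OF * *] u2] by (simp add: algebra_simps)
  next
    assume *: "(\<lambda>e. col (Inl w) e - col (Inl u) e) \<in> edge_span"
    show ?thesis using edge_span.add[OF edge_span.add[OF * *] u2] by (simp add: algebra_simps)
  qed
qed

section \<open>The non-bipartite case and the case of two non-adjacent vertices\<close>

lemma nonbipartite_choosable:
  assumes "connected_graph V E" "degenerate d V E" "prime k" "k > d" "d \<ge> 2" "\<not> bipartite V E"
  shows "pair_choosable 1 k V E"
proof -
  obtain hs where hs: "set hs \<subseteq> V" "length hs = card E"
      "\<not> int k dvd permanent E (map (\<lambda>w. col (Inl w)) hs)"
    using degenerate_permanent[OF assms(2-4) simple] by blast
  \<comment> \<open>Here \<open>d \<ge> 2\<close> matters: it gives \<open>k > 2\<close>, so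
    doubling every column is invertible modulo \<open>k\<close>.\<close>
  have "\<not> int k dvd 2 ^ card E"
  proof
    assume "int k dvd 2 ^ card E"
    moreover have "prime (int k)" using \<open>prime k\<close> by simp
    ultimately have "int k dvd 2" by (metis prime_dvd_power)
    then show False using assms by (auto dest!: zdvd_imp_le)
  qed
  then have "\<not> int k dvd permanent E (map (\<lambda>w e. 2 * col (Inl w) e) hs)"
    using hs \<open>prime k\<close> by (simp add: permanent_scale prime_dvd_mult_iff)
  then show ?thesis
    using hs edge_span_nonbipartite[OF assms(1,6)]
    by (intro pair_choosable_if_permanent[OF \<open>prime k\<close>, of "map (\<lambda>w e. 2 * col (Inl w) e) hs"]) auto
qed

text \<open>The columns \<open>\<plusminus>col u \<plusminus> col v\<close> and \<open>col w \<plusminus> col u\<close> lie in the span even if the graph is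
  bipartite. Repeating the first one \<open>d(u) + d(v)\<close> times uses up all rows of edges at \<open>u\<close> or \<open>v\<close>;
  on the remaining rows the summand \<open>col u\<close> of the other columns vanishes.\<close>

lemma nonadjacent_choosable:
  assumes conn: "connected_graph V E" and "degenerate d V E" "prime k" "k > d"
    and uv: "u \<in> V" "v \<in> V" "u \<noteq> v" "{u, v} \<notin> E"
    and deg: "vertex_degree E u + vertex_degree E v < k"
  shows "pair_choosable 1 k V E"
proof -
  have "\<exists>s. (s = 1 \<or> s = - 1) \<and> (\<lambda>e. col (Inl w) e + s * col (Inl u) e) \<in> edge_span" if "w \<in> V" for w
    using edge_span_connected[OF conn uv(1) that]
  proof
    assume "(\<lambda>e. col (Inl w) e + col (Inl u) e) \<in> edge_span"
    then show ?thesis by (intro exI[of _ 1]) simp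
  next
    assume "(\<lambda>e. col (Inl w) e - col (Inl u) e) \<in> edge_span"
    then show ?thesis by (intro exI[of _ "- 1"]) simp
  qed
  then obtain s :: "'a \<Rightarrow> int" where s: "\<And>w. w \<in> V \<Longrightarrow> s w = 1 \<or> s w = - 1"
      "\<And>w. w \<in> V \<Longrightarrow> (\<lambda>e. col (Inl w) e + s w * col (Inl u) e) \<in> edge_span"
    using bchoice[of V "\<lambda>w s. (s = 1 \<or> s = - 1) \<and> (\<lambda>e. col (Inl w) e + s * col (Inl u) e) \<in> edge_span"]
    by blast
  define c where "c = (\<lambda>w e. col (Inl w) e + s w * col (Inl u) e)"
  define R where "R = incident_edges E u \<union> incident_edges E v"
  have R: "R \<subseteq> E" by (auto simp: R_def incident_edges_def)
  \<comment> \<open>Non-adjacency makes the edges at \<open>u\<close> and at \<open>v\<close>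
    disjoint sets, so on each row of \<open>R\<close> exactly one summand of \<open>c v\<close> is
    nonzero and the entry is a sign.\<close>
  have only_one: "u \<notin> e \<or> v \<notin> e" if "e \<in> E" for e
    using ends[OF that] uv that by (metis doubleton_eq_iff insertE singletonD)
  have "card R = vertex_degree E u + vertex_degree E v"
    unfolding R_def vertex_degree_def
    using only_one finite_E by (intro card_Un_disjoint) (auto simp: incident_edges_def)
  then have cardR: "card R < k" using deg by simp
  have "simple_graph (V - {u, v}) (E - R)"
    using simple by (fastforce simp: simple_graph_def R_def incident_edges_def)
  then obtain hs where hs: "set hs \<subseteq> V - {u, v}" "length hs = card (E - R)"
      "\<not> int k dvd permanent (E - R) (map (\<lambda>w. col (Inl w)) hs)"
    using degenerate_permanent[OF assms(2-4), of "V - {u, v}" "E - R"] by blast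
  have "permanent (E - R) (map c hs) = permanent (E - R) (map (\<lambda>w. col (Inl w)) hs)"
    by (intro permanent_cong)
      (auto simp: list_all2_map1 list_all2_map2 list_all2_same c_def R_def incident_edges_def col_vertex_outside)
  then have nd: "\<not> int k dvd permanent (E - R) (map c hs)" using hs by simp
  have "\<bar>c v e\<bar> = 1" if "e \<in> R" for e
    using that s(1)[OF uv(2)] only_one[of e] R col_vertex_incident[of e] col_vertex_outside[of e]
    by (auto simp: c_def R_def incident_edges_def abs_mult)
  moreover have "permanent E (replicate (card R) (c v) @ map c hs) =
      fact (card R) * (\<Prod>e\<in>R. c v e) * permanent (E - R) (map c hs)"
    using finite_E R
    by (intro permanent_block) (auto simp: c_def R_def incident_edges_def col_vertex_outside)
  ultimately have "\<not> int k dvd permanent E (replicate (card R) (c v) @ map c hs)"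
    using prime_not_dvd_block[OF \<open>prime k\<close> cardR _ nd, of R "c v"] by simp
  moreover have "length (replicate (card R) (c v) @ map c hs) = card E"
    using hs(2) card_mono[OF finite_E R] card_Diff_subset[OF finite_subset[OF R finite_E] R] by simp
  moreover have "set (replicate (card R) (c v) @ map c hs) \<subseteq> edge_span"
    using hs(1) uv s(2) by (auto simp: c_def)
  ultimately show ?thesis by (intro pair_choosable_if_permanent[OF \<open>prime k\<close>])
qed

end

lemma simple_graph_orientation:
  assumes "simple_graph V E"
  obtains src tgt where "oriented_graph V E src tgt"
proof -
  have "\<forall>e\<in>E. \<exists>p. e = {fst p, snd p} \<and> fst p \<noteq> snd p"
    using assms by (auto simp: simple_graph_def card_2_iff)
  then obtain p where "\<forall>e\<in>E. e = {fst (p e), snd (p e)} \<and> fst (p e) \<noteq> snd (p e)"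
    by metis
  then have "oriented_graph V E (fst \<circ> p) (snd \<circ> p)"
    using assms by unfold_locales auto
  then show thesis by (rule that)
qed

theorem theorem1:
  fixes V :: "'a set" and E :: "'a set set" and d k :: nat
  assumes "simple_graph V E"
    and "connected_graph V E"
    and "degenerate d V E"
    and "prime k"
    and "k > d"
    and "d \<ge> 2"
    and "\<not> bipartite V E \<or>
         (bipartite V E \<and>
          (\<exists>u\<in>V. \<exists>v\<in>V. u \<noteq> v \<and> {u, v} \<notin> E \<and> vertex_degree E u + vertex_degree E v < k))"
  shows "pair_choosable 1 k V E"
proof -
  obtain src tgt where "oriented_graph V E src tgt"
    using simple_graph_orientation[OF assms(1)] .
  then interpret oriented_graph V E src tgt .
  show ?thesis
    using assms(7) nonbipartite_choosable[OF assms(2-6)] nonadjacent_choosable[OF assms(2-5)]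
    by blast
qed

end
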